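(* Let $p$ be an odd prime, $e>0$ an integer, and $q=p^e$. Let $k$ be an integer with $1\le k\le q-1$, and let $A_k=X^k\bigl[(X+1)^k-X^k\bigr]\in\mathbb{F}_q[X]$. Then $A_k$ is a permutation polynomial of $\mathbb{F}_q$ if and only if $k$ is a power of $p$.
   Context: $\mathbb{F}_q$ denotes the finite field with $q$ elements. A polynomial $h\in\mathbb{F}_q[X]$ is called a permutation polynomial of $\mathbb{F}_q$ if the map $x\mapsto h(x)$ is a permutation (bijection) of $\mathbb{F}_q$. "Power of $p$" means $p^i$ for some integer $i\ge 0$; in particular $1=p^0$ is included. *)

theory Defs
  imports "HOL-Computational_Algebra.Computational_Algebra"
begin

definition permutation_poly :: "'a :: {field, finite} poly \<Rightarrow> bool" where
  "permutation_poly h \<longleftrightarrow> bij (\<lambda>x. poly h x)"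

abbreviation (input) var_X :: "'a :: comm_ring_1 poly" where
  "var_X \<equiv> [:0, 1:]"

definition A_poly :: "nat \<Rightarrow> 'a :: comm_ring_1 poly" where
  "A_poly k = var_X ^ k * ((var_X + 1) ^ k - var_X ^ k)"

end

(*
Let a be the inverse of k modulo q - 1; it exists because a common factor would give A_k a second
zero. Substituting x = 1 / ((1 + w)^a - 1) turns A_k(x) into G(w)^(-k) with
G(w) = ((1 + w)^a - 1)^2 / w^a, so G permutes the nonzero elements of the field, and the sum of
G(w)^u over w <> 0 vanishes unless q - 1 divides u. For u = u0 + u1 p^j, binomial expansion writes
this power sum as a combination, over v = v0 + v1 p^j with v0 <= 2 u0 and v1 <= 2 u1, of the
binomial coefficients (a v choose a u), both arguments reduced modulo q - 1. If a u has no carries,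
then Lucas' theorem kills every term except those for which a v has no carries either and
dominates a u digitwise. If v = u is the only such v, what remains is the nonzero product of the
central binomial coefficients of u0 and u1: a contradiction.
If the largest digit M of a is at least 2, take u = (p - 1) div M: so all digits of a are 0 or 1.
If a has two digits 1 at distance j, take u = (1 + p^j)(p - 1)/2: where the two copies of the
digits of a overlap a u has digit p - 1, forcing v0 + v1 = p - 1, and the other digits force v0 = v1.
Hence a, and therefore k, is a power of p.
*)
theory Submission
  imports Defs "HOL-Number_Theory.Cong"
begin

section \<open>Base-$p$ digits\<close>

lemma sum_digits:
  fixes n p e :: nat
  assumes "p > 0"
  shows "(\<Sum>i<e. n div p ^ i mod p * p ^ i) = n mod p ^ e"
proof (induction e)
  case (Suc e)
  have "n mod p ^ Suc e = p ^ e * (n div p ^ e mod p) + n mod p ^ e"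
    by (simp only: power_Suc2 mod_mult2_eq)
  with Suc show ?case by (simp add: mult.commute)
qed simp

text \<open>Reduction modulo \<open>p\<close> leaves only \<open>E 0\<close>, which is too small in
  absolute value to be a nonzero multiple of \<open>p\<close>; division by \<open>p\<close> then
  shifts the digits down. Applied to the difference of two expansions, this is uniqueness of
  digits.\<close>

lemma signed_digits_eq_0:
  fixes E :: "nat \<Rightarrow> int" and p :: int
  assumes "(\<Sum>i<e. E i * p ^ i) = 0" and "\<And>i. i < e \<Longrightarrow> \<bar>E i\<bar> < p" and "i < e"
  shows "E i = 0"
  using assms
proof (induction e arbitrary: E i)
  case (Suc e)
  have "p > 0" using Suc.prems(2)[of 0] by linarith
  let ?R = "\<Sum>i<e. E (Suc i) * p ^ i"
  have eq: "E 0 + p * ?R = 0"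
    using Suc.prems(1)
    by (simp add: sum.lessThan_Suc_shift sum_distrib_left mult.assoc mult.left_commute del: sum.lessThan_Suc)
  hence "p dvd E 0" by (metis dvd_triv_left dvd_add_left_iff dvd_0_right)
  hence "E 0 = 0" using Suc.prems(2)[of 0] using dvd_imp_le_int[of "E 0" p] by force
  moreover from this eq have "?R = 0" using \<open>p > 0\<close> by simp
  hence "E (Suc i) = 0" if "i < e" for i
    using Suc.IH[of "\<lambda>i. E (Suc i)" i] Suc.prems(2) that by simp
  ultimately show ?case using Suc.prems(3) by (cases i) auto
qed simp

lemma digits_of_sum:
  fixes A :: "nat \<Rightarrow> nat"
  assumes "\<And>i. i < e \<Longrightarrow> A i < p" and "i < e"
  shows "(\<Sum>i<e. A i * p ^ i) div p ^ i mod p = A i"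
    and "(\<Sum>i<e. A i * p ^ i) < p ^ e"
proof -
  have p: "p > 0" using assms by fastforce
  have bound: "(\<Sum>i<n. A i * p ^ i) < p ^ n" if "n \<le> e" for n
    using that
  proof (induction n)
    case (Suc n)
    have "(\<Sum>i<Suc n. A i * p ^ i) < p ^ n + A n * p ^ n" using Suc by simp
    also have "\<dots> = (A n + 1) * p ^ n" by simp
    also have "\<dots> \<le> p * p ^ n" using assms(1)[of n] Suc.prems by (intro mult_right_mono) auto
    finally show ?case by simp
  qed simp
  show lt: "(\<Sum>i<e. A i * p ^ i) < p ^ e" using bound by simp
  let ?n = "\<Sum>i<e. A i * p ^ i"
  have "int (\<Sum>i<e. ?n div p ^ i mod p * p ^ i) = int (\<Sum>i<e. A i * p ^ i)"
    using sum_digits[OF p, of ?n e] lt by simp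
  hence "(\<Sum>i<e. (int (?n div p ^ i mod p) - int (A i)) * int p ^ i) = 0"
    by (simp add: left_diff_distrib sum_subtractf)
  moreover have "\<bar>int (?n div p ^ i mod p) - int (A i)\<bar> < int p" if "i < e" for i
    using assms(1)[OF that] pos_mod_bound[of p] mod_less_divisor[OF p, of "?n div p ^ i"] by linarith
  ultimately have "int (?n div p ^ i mod p) - int (A i) = 0"
    using assms(2) by (rule signed_digits_eq_0)
  thus "?n div p ^ i mod p = A i" by linarith
qed

lemma int_geometric_digits:
  fixes p :: int
  shows "(\<Sum>i<e. (p - 1) * p ^ i) = p ^ e - 1"
  by (simp add: power_diff_1_eq sum_distrib_left)

lemma sum_full_digits:
  fixes p :: nat
  assumes "p > 0"
  shows "(\<Sum>i<e. (p - 1) * p ^ i) = p ^ e - 1"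
proof -
  have "int (\<Sum>i<e. (p - 1) * p ^ i) = int (p ^ e - 1)"
    using int_geometric_digits[of "int p" e] assms by (simp add: of_nat_diff)
  thus ?thesis by linarith
qed

text \<open>By the triangle inequality the sum is at most \<open>p ^ e - 1\<close> in absolute
  value, so it is zero or one of the two extremes. An extreme is attained only if every digit is
  extreme with the same sign.\<close>

lemma signed_digits_cyclic:
  fixes E :: "nat \<Rightarrow> int" and p :: int
  assumes "p ^ e - 1 dvd (\<Sum>i<e. E i * p ^ i)" and bd: "\<And>i. i < e \<Longrightarrow> \<bar>E i\<bar> \<le> p - 1" and p: "p \<ge> 2"
  shows "(\<forall>i<e. E i = 0) \<or> (\<forall>i<e. E i = p - 1) \<or> (\<forall>i<e. E i = - (p - 1))"
proof (cases "e = 0")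
  case False
  let ?S = "\<Sum>i<e. E i * p ^ i"
  have nonneg_all: "\<forall>i<e. F i = 0"
    if "(\<Sum>i<e. F i * p ^ i) = 0" and "\<And>i. i < e \<Longrightarrow> F i \<ge> 0" for F
  proof -
    have "\<forall>i\<in>{..<e}. F i * p ^ i = 0"
      using that p by (subst sum_nonneg_eq_0_iff[symmetric]) auto
    thus ?thesis using p by auto
  qed
  have "\<bar>?S\<bar> \<le> (\<Sum>i<e. \<bar>E i * p ^ i\<bar>)" by (rule sum_abs)
  also have "\<dots> \<le> (\<Sum>i<e. (p - 1) * p ^ i)"
    using bd p by (intro sum_mono) (auto simp: abs_mult intro!: mult_right_mono)
  finally have le: "\<bar>?S\<bar> \<le> p ^ e - 1" by (simp add: int_geometric_digits)
  have pos: "p ^ e - 1 > 0" using p False by simp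
  obtain c where c: "?S = (p ^ e - 1) * c" using assms(1) by auto
  have "\<bar>c\<bar> \<le> 1"
  proof (rule ccontr)
    assume "\<not> \<bar>c\<bar> \<le> 1"
    hence "(p ^ e - 1) * 2 \<le> (p ^ e - 1) * \<bar>c\<bar>" using pos by (intro mult_left_mono) auto
    also have "\<dots> = \<bar>?S\<bar>" using c pos by (simp add: abs_mult)
    also have "\<dots> \<le> (p ^ e - 1) * 1" using le by simp
    finally show False using pos by (simp only: mult_le_cancel_left_pos)
  qed
  then consider "c = 0" | "c = 1" | "c = -1" by linarith
  thus ?thesis
  proof cases
    case 1
    then have "?S = 0" using c by simp
    hence "E i = 0" if "i < e" for i
      using signed_digits_eq_0[of E p e i] bd that by force
    thus ?thesis by blast
  next
    case 2
    have "(\<Sum>i<e. (p - 1 - E i) * p ^ i) = (\<Sum>i<e. (p - 1) * p ^ i) - ?S"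
      by (simp only: left_diff_distrib[of "p - 1"] sum_subtractf)
    also have "\<dots> = 0" using 2 c by (simp add: int_geometric_digits)
    finally have "\<forall>i<e. p - 1 - E i = 0" by (rule nonneg_all) (use bd in fastforce)
    thus ?thesis by simp
  next
    case 3
    have "(\<Sum>i<e. (p - 1 + E i) * p ^ i) = (\<Sum>i<e. (p - 1) * p ^ i) + ?S"
      by (simp only: distrib_right[of "p - 1"] sum.distrib)
    also have "\<dots> = 0" using 3 c by (simp add: int_geometric_digits)
    finally have "\<forall>i<e. p - 1 + E i = 0" by (rule nonneg_all) (use bd in fastforce)
    thus ?thesis by force
  qed
qed simp

section \<open>Lucas' theorem in prime characteristic, and the digits it forces\<close>

lemma coeff_1_plus_X_power:
  "coeff ([:1, 1:] ^ n :: 'a :: comm_ring_1 poly) i = of_nat (n choose i)"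
proof (cases "i \<le> n")
  case False
  hence "degree ([:1, 1:] ^ n :: 'a poly) < i"
    using degree_power_le[of "[:1, 1:] :: 'a poly" n] by simp
  thus ?thesis using False by (simp add: coeff_eq_0 binomial_eq_0)
qed (simp add: coeff_linear_poly_power)

text \<open>One digit of Lucas' theorem: compare coefficients of \<open>X ^ k\<close> after writing
  \<open>(1 + X) ^ n\<close> as \<open>(1 + X ^ p) ^ (n div p) * (1 + X) ^ (n mod p)\<close>. The
  last factor has degree below \<open>p\<close>, so only \<open>m = k div p\<close>
  contributes.\<close>

lemma lucas_step:
  assumes "prime CHAR('a :: comm_ring_1)"
  defines "p \<equiv> CHAR('a)"
  shows "(of_nat (n choose k) :: 'a) = of_nat (n div p choose (k div p)) * of_nat (n mod p choose (k mod p))"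
proof -
  have p: "p > 0" using assms prime_gt_0_nat by blast
  have pr: "prime CHAR('a poly)" using assms by simp
  let ?X = "[:0, 1:] :: 'a poly"
  let ?r = "n mod p"
  have lin: "[:1, 1:] = ?X + 1" by (simp add: one_pCons)
  have "[:1, 1:] ^ n = (([:1, 1:] :: 'a poly) ^ p) ^ (n div p) * [:1, 1:] ^ ?r"
    by (simp flip: power_mult power_add)
  also have "([:1, 1:] :: 'a poly) ^ p = monom 1 p + 1"
    unfolding lin using freshmans_dream[OF pr, of p ?X 1] by (simp add: p_def monom_altdef)
  also have "(monom 1 p + 1 :: 'a poly) ^ (n div p) = (\<Sum>m\<le>n div p. monom (of_nat (n div p choose m)) (p * m))"
    by (simp add: binomial_ring monom_power of_nat_monom mult_monom)
  finally have "[:1, 1:] ^ n = (\<Sum>m\<le>n div p. monom (of_nat (n div p choose m)) (p * m) * ([:1, 1:] :: 'a poly) ^ ?r)"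
    by (simp add: sum_distrib_right)
  hence "coeff ([:1, 1:] ^ n :: 'a poly) k
    = (\<Sum>m\<le>n div p. if k < p * m then 0 else of_nat (n div p choose m) * of_nat (?r choose (k - p * m)))"
    by (simp add: coeff_sum coeff_monom_mult coeff_1_plus_X_power cong: if_cong)
  also have "\<dots> = (\<Sum>m\<le>n div p. if m = k div p then of_nat (n div p choose (k div p)) * of_nat (?r choose (k mod p)) else 0)"
  proof (intro sum.cong refl)
    fix m
    consider "m = k div p" | "m > k div p" | "m < k div p" by linarith
    thus "(if k < p * m then 0 else of_nat (n div p choose m) * of_nat (?r choose (k - p * m))) =
      (if m = k div p then of_nat (n div p choose (k div p)) * of_nat (?r choose (k mod p)) else (0 :: 'a))"
    proof cases
      case 1
      have "\<not> k < p * (k div p)" by (simp add: not_less)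
      thus ?thesis using 1 by (simp add: minus_mult_div_eq_mod)
    next
      case 2
      hence "k < p * m" using p by (simp add: div_less_iff_less_mult mult.commute)
      thus ?thesis using 2 by simp
    next
      case 3
      hence "p * (m + 1) \<le> p * (k div p)" by (intro mult_left_mono) auto
      also have "\<dots> \<le> k" by simp
      finally have "?r < k - p * m" using mod_less_divisor[OF p, of n] by (simp add: algebra_simps)
      thus ?thesis using 3 by (simp add: binomial_eq_0)
    qed
  qed
  also have "\<dots> = of_nat (n div p choose (k div p)) * of_nat (?r choose (k mod p))"
    by (simp add: binomial_eq_0)
  finally show ?thesis by (simp add: coeff_1_plus_X_power)
qed

text \<open>Each digit position contributes a factor in Lucas' theorem, and a digit of
  \<open>k\<close> above the one of \<open>n\<close> makes its factor zero.\<close>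

lemma digit_le_if_binomial_nonzero:
  assumes "prime CHAR('a :: comm_ring_1)" and "(of_nat (n choose k) :: 'a) \<noteq> 0"
  shows "k div CHAR('a) ^ i mod CHAR('a) \<le> n div CHAR('a) ^ i mod CHAR('a)"
  using assms(2)
proof (induction i arbitrary: n k)
  case 0
  thus ?case using lucas_step[OF assms(1), of n k] binomial_eq_0[of "n mod CHAR('a)" "k mod CHAR('a)"]
    by (cases "n mod CHAR('a) < k mod CHAR('a)") auto
next
  case (Suc i)
  have "(of_nat (n div CHAR('a) choose (k div CHAR('a))) :: 'a) \<noteq> 0"
    using Suc.prems lucas_step[OF assms(1), of n k] by auto
  from Suc.IH[OF this] show ?case by (simp add: div_mult2_eq)
qed

text \<open>
  The digitwise difference of \<open>N\<close> and \<open>V\<close> is bounded by \<open>p - 1\<close> and sums to a multiple of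
  \<open>p ^ e - 1\<close>, so it is constantly \<open>0\<close>, \<open>p - 1\<close> or \<open>- (p - 1)\<close>; the last two force \<open>V = 0\<close> and
  \<open>K = p - 1\<close>, respectively.
\<close>
lemma digits_forced:
  fixes K V :: "nat \<Rightarrow> nat" and p e N :: nat
  assumes p: "p \<ge> 2" and K: "\<And>i. i < e \<Longrightarrow> K i \<le> p - 1" "\<exists>i<e. K i \<noteq> p - 1"
    and V: "\<And>i. i < e \<Longrightarrow> V i \<le> 2 * K i"
    and N: "[N = (\<Sum>i<e. V i * p ^ i)] (mod (p ^ e - 1))" "N < p ^ e"
    and N0: "(\<Sum>i<e. V i * p ^ i) = 0 \<Longrightarrow> N = 0"
    and le: "\<And>i. i < e \<Longrightarrow> K i \<le> N div p ^ i mod p"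
    and i: "i < e"
  shows "N div p ^ i mod p = V i"
proof -
  define E where "E i = int (N div p ^ i mod p) - int (V i)" for i
  have dig: "N div p ^ i mod p \<le> p - 1" for i
    using p mod_less_divisor[of p "N div p ^ i"] by linarith
  have "int N = int (\<Sum>i<e. N div p ^ i mod p * p ^ i)"
    using sum_digits[of p N e] p N(2) by simp
  hence "(\<Sum>i<e. E i * int p ^ i) = int N - int (\<Sum>i<e. V i * p ^ i)"
    by (simp add: E_def left_diff_distrib sum_subtractf)
  moreover have "int (p ^ e - 1) dvd int N - int (\<Sum>i<e. V i * p ^ i)"
    using N(1) by (simp only: cong_int_iff[symmetric] cong_iff_dvd_diff)
  moreover have "int (p ^ e - 1) = int p ^ e - 1"
    using p by (simp add: of_nat_diff)
  ultimately have dvd: "int p ^ e - 1 dvd (\<Sum>i<e. E i * int p ^ i)" by simp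
  have bd: "\<bar>E i\<bar> \<le> int p - 1" if "i < e" for i
    using dig[of i] K(1)[OF that] V[OF that] le[OF that] p by (auto simp: E_def)
  consider "\<forall>i<e. E i = 0" | "\<forall>i<e. E i = int p - 1" | "\<forall>i<e. E i = - (int p - 1)"
    using signed_digits_cyclic[OF dvd bd] p by auto
  thus ?thesis
  proof cases
    case 1
    thus ?thesis using i by (simp add: E_def)
  next
    case 2
    have d: "N div p ^ i mod p = p - 1 \<and> V i = 0" if "i < e" for i
      using 2[rule_format, OF that] dig[of i] p by (auto simp: E_def)
    \<comment> \<open>\<open>N0\<close> excludes \<open>p ^ e - 1\<close> as the representative of
      the zero residue.\<close>
    hence "N = 0" by (intro N0) simp
    thus ?thesis using d[OF i] p by simp
  next
    case 3
    have "K i = p - 1" if "i < e" for i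
      using 3[rule_format, OF that] dig[of i] p K(1)[OF that] V[OF that] le[OF that]
      by (auto simp: E_def)
    thus ?thesis using K(2) by blast
  qed
qed

section \<open>Power sums over a finite field\<close>

lemma power_card_minus_1:
  fixes x :: "'a :: {field, finite}"
  assumes "x \<noteq> 0"
  shows "x ^ (card (UNIV :: 'a set) - 1) = 1"
proof -
  have "(\<Prod>y\<in>UNIV-{0}. x * y) = (\<Prod>y\<in>UNIV-{0}. y)"
    by (rule prod.reindex_bij_witness[of _ "\<lambda>y. y / x" "\<lambda>y. x * y"]) (use assms in auto)
  moreover have "(\<Prod>y\<in>UNIV-{0::'a}. y) \<noteq> 0" by simp
  ultimately show ?thesis by (simp add: prod.distrib card_Diff_singleton)
qed

lemma power_eq_power_if_cong:
  fixes x :: "'a :: {field, finite}"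
  assumes "[m = n] (mod (card (UNIV :: 'a set) - 1))" and "x = 0 \<Longrightarrow> m = 0 \<longleftrightarrow> n = 0"
  shows "x ^ m = x ^ n"
proof (cases "x = 0")
  case False
  let ?Q = "card (UNIV :: 'a set) - 1"
  have "x ^ m = x ^ (m mod ?Q)" for m
  proof -
    have "x ^ m = x ^ (?Q * (m div ?Q) + m mod ?Q)" by simp
    also have "\<dots> = x ^ (m mod ?Q)"
      by (simp only: power_add power_mult power_card_minus_1[OF False]) simp
    finally show ?thesis .
  qed
  from this[of m] this[of n] assms(1) show ?thesis by (simp add: cong_def)
qed (use assms(2) in \<open>auto simp: power_0_left\<close>)

text \<open>The polynomial \<open>X ^ r - 1\<close> has at most \<open>r\<close> roots, too few to
  cover all nonzero elements.\<close>

lemma ex_power_neq_1: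
  assumes "0 < r" and "r < card (UNIV :: 'a set) - 1"
  shows "\<exists>x::'a::{field, finite}. x \<noteq> 0 \<and> x ^ r \<noteq> 1"
proof (rule ccontr)
  assume "\<not> ?thesis"
  hence sub: "UNIV - {0} \<subseteq> {x::'a. poly (monom 1 r - 1) x = 0}"
    by (auto simp: poly_monom)
  have nz: "(monom 1 r - 1 :: 'a poly) \<noteq> 0"
  proof
    assume "(monom 1 r - 1 :: 'a poly) = 0"
    hence "poly (monom 1 r - 1 :: 'a poly) 0 = 0" by simp
    thus False using assms(1) by (simp add: poly_monom power_0_left)
  qed
  have "card (UNIV :: 'a set) - 1 = card (UNIV - {0::'a})" by (simp add: card_Diff_singleton)
  also have "\<dots> \<le> card {x::'a. poly (monom 1 r - 1) x = 0}"
    by (rule card_mono) (use sub in auto)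
  also have "\<dots> \<le> degree (monom 1 r - 1 :: 'a poly)" by (rule card_poly_roots_bound[OF nz])
  also have "\<dots> \<le> r" by (rule degree_diff_le) (auto simp: degree_monom_le)
  finally show False using assms(2) by simp
qed

lemma of_nat_card_UNIV_eq_0: "of_nat (card (UNIV :: 'a set)) = (0 :: 'a :: {field, finite})"
proof -
  have "(\<Sum>x\<in>UNIV. x) = (\<Sum>x\<in>UNIV. x + (1 :: 'a))"
    by (rule sum.reindex_bij_witness[of _ "\<lambda>x. x + 1" "\<lambda>x. x - 1"]) auto
  thus ?thesis by (simp add: sum.distrib)
qed

lemma CHAR_eq_if_card_eq_prime_power:
  assumes "prime p" and "card (UNIV :: 'a :: {field, finite} set) = p ^ e"
  shows "CHAR('a) = p"
proof -
  have "CHAR('a) dvd p ^ e"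
    using of_nat_card_UNIV_eq_0[where 'a = 'a] unfolding assms(2) of_nat_eq_0_iff_char_dvd .
  moreover have "prime CHAR('a)"
    using finite_imp_CHAR_pos[where 'a = 'a] by (intro prime_CHAR_semidom) simp
  ultimately show ?thesis using assms(1) by (meson prime_dvd_power primes_dvd_imp_eq)
qed

text \<open>If \<open>q - 1\<close> does not divide \<open>m\<close>, some nonzero \<open>g\<close>
  has \<open>g ^ m \<noteq> 1\<close>, and substituting \<open>g * x\<close> multiplies the sum by
  \<open>g ^ m\<close>. Otherwise every nonzero \<open>x\<close> contributes 1; for
  \<open>m = 0\<close> the term \<open>0 ^ 0 = 1\<close> raises the count to \<open>q\<close>, which
  is zero in the field.\<close>

lemma sum_powers_finite_field:
  "(\<Sum>x\<in>UNIV. x ^ m :: 'a :: {field, finite}) =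
    (if m > 0 \<and> card (UNIV :: 'a set) - 1 dvd m then - 1 else 0)"
proof (cases "card (UNIV :: 'a set) - 1 dvd m")
  case True
  show ?thesis
  proof (cases "m = 0")
    case True
    thus ?thesis by (simp add: of_nat_card_UNIV_eq_0)
  next
    case m: False
    have "x ^ m = 1" if "x \<noteq> 0" for x :: 'a
      using power_eq_power_if_cong[of m 0 x] True that by (simp add: cong_0_iff)
    hence "(\<Sum>x\<in>UNIV - {0::'a}. x ^ m) = of_nat (card (UNIV :: 'a set) - 1)"
      by (simp add: card_Diff_singleton)
    also have "\<dots> = -1"
      using of_nat_card_UNIV_eq_0[where 'a = 'a] by (subst of_nat_diff) (auto simp: Suc_le_eq card_gt_0_iff)
    finally show ?thesis
      using True m by (subst sum.remove[of _ 0]) (auto simp: power_0_left)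
  qed
next
  case False
  let ?r = "m mod (card (UNIV :: 'a set) - 1)"
  have "card {0, 1 :: 'a} \<le> card (UNIV :: 'a set)" by (rule card_mono) auto
  hence "card (UNIV :: 'a set) - 1 > 0" by simp
  hence "?r < card (UNIV :: 'a set) - 1" by (rule mod_less_divisor)
  moreover have "0 < ?r" using False by (simp only: mod_greater_zero_iff_not_dvd not_False_eq_True)
  ultimately obtain g :: 'a where g: "g \<noteq> 0" "g ^ ?r \<noteq> 1"
    using ex_power_neq_1[of ?r] by blast
  have "g ^ m = g ^ ?r" by (rule power_eq_power_if_cong) (use g in \<open>auto simp: cong_def\<close>)
  have "(\<Sum>x\<in>UNIV. x ^ m) = (\<Sum>x\<in>UNIV. (g * x) ^ m)"
    by (rule sum.reindex_bij_witness[of _ "\<lambda>x. g * x" "\<lambda>x. x / g"]) (use g in auto)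
  also have "\<dots> = g ^ ?r * (\<Sum>x\<in>UNIV. x ^ m)"
    by (simp only: power_mult_distrib \<open>g ^ m = g ^ ?r\<close> sum_distrib_left)
  finally have "(\<Sum>x\<in>UNIV. x ^ m) = g ^ ?r * (\<Sum>x\<in>UNIV. x ^ m)" .
  thus ?thesis using g False by simp
qed

text \<open>The factor \<open>w ^ (Q - K)\<close> stands for \<open>w ^ (- K)\<close> and extracts a
  binomial coefficient. The exponents \<open>m + (Q - K)\<close> lie strictly between
  \<open>0\<close> and \<open>2 * Q\<close>, so the power sum survives only at \<open>m = K\<close>,
  where it is \<open>- 1\<close>.\<close>

lemma sum_binomial_power_finite_field:
  fixes K N :: nat
  defines "Q \<equiv> card (UNIV :: 'a :: {field, finite} set) - 1"
  assumes "0 < K" "K < Q" "N \<le> Q"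
  shows "(\<Sum>w\<in>UNIV. (1 + w) ^ N * w ^ (Q - K) :: 'a) = - of_nat (N choose K)"
proof -
  have "(\<Sum>w\<in>UNIV. (1 + w) ^ N * w ^ (Q - K) :: 'a) =
      (\<Sum>w\<in>UNIV. \<Sum>m\<le>N. of_nat (N choose m) * w ^ (m + (Q - K)))"
    by (subst add.commute) (simp add: binomial_ring sum_distrib_right power_add mult.assoc)
  also have "\<dots> = (\<Sum>m\<le>N. of_nat (N choose m) * (\<Sum>w\<in>UNIV. w ^ (m + (Q - K))))"
    by (subst sum.swap) (simp add: sum_distrib_left)
  also have "\<dots> = (\<Sum>m\<le>N. if m = K then - of_nat (N choose K) else 0)"
  proof (intro sum.cong refl)
    fix m assume "m \<in> {..N}"
    hence m: "m + (Q - K) > 0" "m + (Q - K) < 2 * Q" using assms by auto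
    have "Q dvd m + (Q - K) \<longleftrightarrow> m = K"
    proof
      assume "Q dvd m + (Q - K)"
      then obtain c where c: "m + (Q - K) = Q * c" by auto
      have "c \<noteq> 0" using m c by (intro notI) simp
      moreover have "c < 2" using m c by (simp add: mult.commute)
      ultimately have "c = 1" by linarith
      thus "m = K" using c assms by simp
    qed (use assms in auto)
    thus "of_nat (N choose m) * (\<Sum>w\<in>UNIV. w ^ (m + (Q - K)) :: 'a) =
        (if m = K then - of_nat (N choose K) else 0)"
      using m unfolding Q_def by (simp add: sum_powers_finite_field)
  qed
  also have "\<dots> = - of_nat (N choose K)"
    by (simp add: binomial_eq_0)
  finally show ?thesis .
qed

section \<open>The double power sum, evaluated by binomial expansion\<close>

text \<open>Expanding both even powers gives the terms \<open>T v0 v1\<close>, each minus a binomial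
  coefficient over \<open>k\<close>. By Lucas' theorem and \<open>digits_forced\<close>, a nonzero
  one has upper argument with digits \<open>v0 * A i + v1 * B i\<close> that dominate
  \<open>K i\<close>, and \<open>unique\<close> leaves only \<open>(u0, u1)\<close>.\<close>

lemma double_power_sum_nonzero:
  fixes A B :: "nat \<Rightarrow> nat" and p e u0 u1 :: nat
  defines "a \<equiv> \<Sum>i<e. A i * p ^ i" and "b \<equiv> \<Sum>i<e. B i * p ^ i"
    and "K \<equiv> \<lambda>i. u0 * A i + u1 * B i"
  assumes p: "prime p" and card: "card (UNIV :: 'a :: {field, finite} set) = p ^ e"
    and K: "\<And>i. i < e \<Longrightarrow> K i \<le> p - 1" "\<exists>i<e. K i \<noteq> p - 1" "\<exists>i<e. K i \<noteq> 0"
    and central: "\<not> p dvd (2 * u0 choose u0)" "\<not> p dvd (2 * u1 choose u1)"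
    and unique: "\<And>v0 v1. v0 \<le> 2 * u0 \<Longrightarrow> v1 \<le> 2 * u1 \<Longrightarrow>
      (\<And>i. i < e \<Longrightarrow> K i \<le> v0 * A i + v1 * B i) \<Longrightarrow>
      (\<And>i. i < e \<Longrightarrow> v0 * A i + v1 * B i \<le> p - 1) \<Longrightarrow> v0 = u0 \<and> v1 = u1"
  shows "(\<Sum>w\<in>UNIV. ((1 + w) ^ a - 1) ^ (2 * u0) * ((1 + w) ^ b - 1) ^ (2 * u1) *
    w ^ (p ^ e - 1 - (a * u0 + b * u1))) \<noteq> (0 :: 'a)"
proof -
  define Q where "Q = p ^ e - 1"
  have Q: "Q = card (UNIV :: 'a set) - 1" by (simp add: Q_def card)
  define k where "k = a * u0 + b * u1"
  have CHAR: "CHAR('a) = p" by (rule CHAR_eq_if_card_eq_prime_power[OF p card])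
  have p2: "p \<ge> 2" using p by (rule prime_ge_2_nat)
  have M: "a * v0 + b * v1 = (\<Sum>i<e. (v0 * A i + v1 * B i) * p ^ i)" for v0 v1
    by (simp add: a_def b_def sum_distrib_left sum.distrib algebra_simps)
  have k_eq: "k = (\<Sum>i<e. K i * p ^ i)" unfolding k_def M K_def ..
  have Kp: "K i < p" if "i < e" for i using K(1)[OF that] p2 by simp
  have dig_k: "k div p ^ i mod p = K i" if "i < e" for i
    unfolding k_eq using Kp that by (rule digits_of_sum(1))
  have "e > 0" using K(2) by auto
  have "k > 0" using K(3) dig_k by (metis div_0 mod_0 gr0I)
  have "k < p ^ e" unfolding k_eq using Kp \<open>e > 0\<close> by (rule digits_of_sum(2))
  moreover have "k \<noteq> Q"
  proof
    assume "k = Q"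
    have Q_dig: "Q = (\<Sum>i<e. (p - 1) * p ^ i)"
      unfolding Q_def by (rule sum_full_digits[symmetric]) (use p2 in simp)
    have "K i = p - 1" if "i < e" for i
      using digits_of_sum(1)[of e "\<lambda>_. p - 1" p i] p2 dig_k[OF that] that
      unfolding \<open>k = Q\<close> Q_dig by simp
    thus False using K(2) by blast
  qed
  ultimately have "k < Q" by (simp add: Q_def)
  define T where "T v0 v1 = (\<Sum>w\<in>UNIV. (1 + w) ^ (a * v0 + b * v1) * w ^ (Q - k) :: 'a)" for v0 v1
  define c where "c u v = (of_nat (2 * u choose v) * (- 1) ^ (2 * u - v) :: 'a)" for u v :: nat
  have T_eq_0: "T v0 v1 = 0" if v: "v0 \<le> 2 * u0" "v1 \<le> 2 * u1" "(v0, v1) \<noteq> (u0, u1)" for v0 v1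
  proof (rule ccontr)
    assume nz: "T v0 v1 \<noteq> 0"
    define m where "m = a * v0 + b * v1"
    \<comment> \<open>A positive multiple of \<open>Q\<close> is reduced to \<open>Q\<close> and not to \<open>0\<close>, so that \<open>w = - 1\<close> causes no exception.\<close>
    define N where "N = (if m = 0 then 0 else 1 + (m - 1) mod Q)"
    have "Q > 0" using \<open>k < Q\<close> by simp
    hence NQ: "N \<le> Q" using mod_less_divisor[of Q "m - 1"] by (auto simp: N_def Suc_le_eq)
    have cong: "[N = m] (mod Q)"
    proof (cases "m = 0")
      case False
      have "[1 + (m - 1) mod Q = 1 + (m - 1)] (mod Q)" by (intro cong_add) (auto simp: cong_def)
      thus ?thesis using False by (simp add: N_def)
    qed (simp add: N_def)
    have "T v0 v1 = (\<Sum>w\<in>UNIV. (1 + w) ^ N * w ^ (Q - k))"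
      unfolding T_def m_def[symmetric]
    proof (intro sum.cong refl arg_cong2[where f = "(*)"])
      fix w :: 'a
      show "(1 + w) ^ m = (1 + w) ^ N"
        by (rule power_eq_power_if_cong)
          (use cong_sym[OF cong] in \<open>simp_all only: Q[symmetric]\<close>, simp add: N_def)
    qed
    also have "\<dots> = - of_nat (N choose k)"
      unfolding Q by (rule sum_binomial_power_finite_field)
        (use \<open>k > 0\<close> \<open>k < Q\<close> NQ Q in auto)
    finally have "(of_nat (N choose k) :: 'a) \<noteq> 0" using nz by simp
    hence le: "K i \<le> N div p ^ i mod p" if "i < e" for i
      using digit_le_if_binomial_nonzero[of N k i, where 'a = 'a] p that dig_k by (simp add: CHAR)
    have dig: "N div p ^ i mod p = v0 * A i + v1 * B i" if "i < e" for i
    proof (rule digits_forced[of p e K "\<lambda>i. v0 * A i + v1 * B i"])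
      show "v0 * A i + v1 * B i \<le> 2 * K i" for i
        using mult_le_mono1[OF v(1), of "A i"] mult_le_mono1[OF v(2), of "B i"]
        unfolding K_def distrib_left mult.assoc[symmetric] by (rule add_mono)
      show "[N = (\<Sum>i<e. (v0 * A i + v1 * B i) * p ^ i)] (mod p ^ e - 1)"
        using cong unfolding M[symmetric] m_def Q_def .
      show "N < p ^ e" using NQ zero_less_power[of p e] p2 unfolding Q_def by linarith
      show "(\<Sum>i<e. (v0 * A i + v1 * B i) * p ^ i) = 0 \<Longrightarrow> N = 0"
        unfolding M[symmetric] by (simp add: N_def m_def)
    qed (use K p2 le that in auto)
    have "v0 = u0 \<and> v1 = u1"
    proof (rule unique[OF v(1,2)])
      fix i assume "i < e"
      show "K i \<le> v0 * A i + v1 * B i" using le[OF \<open>i < e\<close>] dig[OF \<open>i < e\<close>] by simp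
      show "v0 * A i + v1 * B i \<le> p - 1"
        using p2 mod_less_divisor[of p "N div p ^ i"] unfolding dig[OF \<open>i < e\<close>, symmetric] by linarith
    qed
    thus False using v(3) by simp
  qed
  have T_u: "T u0 u1 = - 1"
  proof -
    have "T u0 u1 = - of_nat (k choose k)"
      unfolding T_def k_def[symmetric] Q by (rule sum_binomial_power_finite_field)
        (use \<open>k > 0\<close> \<open>k < Q\<close> Q in auto)
    thus ?thesis by simp
  qed
  have expand: "(x - 1) ^ (2 * u) = (\<Sum>v\<le>2 * u. c u v * x ^ v)" for x :: 'a and u
    using binomial_ring[of x "- 1" "2 * u"] by (simp add: c_def mult_ac)
  have pw: "(1 + w) ^ (a * v0 + b * v1) = ((1 + w) ^ a) ^ v0 * ((1 + w) ^ b) ^ v1" for w :: 'a and v0 v1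
    by (simp only: power_add power_mult)
  have "(\<Sum>w\<in>UNIV. ((1 + w) ^ a - 1) ^ (2 * u0) * ((1 + w) ^ b - 1) ^ (2 * u1) * w ^ (Q - k))
      = (\<Sum>w\<in>UNIV. \<Sum>v0\<le>2 * u0. \<Sum>v1\<le>2 * u1.
          c u0 v0 * c u1 v1 * ((1 + w) ^ (a * v0 + b * v1) * w ^ (Q - k)) :: 'a)"
    unfolding expand unfolding sum_product unfolding sum_distrib_right
    by (intro sum.cong refl) (simp only: pw, simp only: mult_ac)
  also have "\<dots> = (\<Sum>v0\<le>2 * u0. \<Sum>v1\<le>2 * u1. c u0 v0 * c u1 v1 * T v0 v1)"
    unfolding T_def sum_distrib_left by (subst sum.swap, intro sum.cong refl, subst sum.swap) simp
  also have "\<dots> = (\<Sum>(v0, v1)\<in>{..2 * u0} \<times> {..2 * u1}. c u0 v0 * c u1 v1 * T v0 v1)"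
    by (rule sum.cartesian_product)
  also have "\<dots> = (\<Sum>(v0, v1)\<in>{(u0, u1)}. c u0 v0 * c u1 v1 * T v0 v1)"
  proof (rule sum.mono_neutral_right; (intro ballI)?)
    fix v assume "v \<in> {..2 * u0} \<times> {..2 * u1} - {(u0, u1)}"
    thus "(case v of (v0, v1) \<Rightarrow> c u0 v0 * c u1 v1 * T v0 v1) = 0"
      using T_eq_0[of "fst v" "snd v"] by (cases v) auto
  qed auto
  also have "\<dots> = - (c u0 u0 * c u1 u1)" by (simp add: T_u)
  \<comment> \<open>Up to sign, \<open>c u u\<close> is the central binomial coefficient of
    \<open>u\<close>.\<close>
  also have "\<dots> \<noteq> 0"
    using central by (simp add: c_def of_nat_eq_0_iff_char_dvd CHAR)
  finally show ?thesis by (simp add: Q_def k_def)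
qed

section \<open>The inverse of the exponent\<close>

lemma poly_A_poly: "poly (A_poly k) x = x ^ k * ((x + 1) ^ k - x ^ k)"
  by (simp add: A_poly_def add.commute)

text \<open>A common prime factor of \<open>k\<close> and \<open>q - 1\<close> yields some
  \<open>z \<noteq> 1\<close> with \<open>z ^ k = 1\<close>. The point \<open>x\<close> with
  \<open>(x + 1) / x = z\<close> is then a zero of \<open>A_poly k\<close> other than
  \<open>0\<close>.\<close>

lemma coprime_if_permutation_A_poly:
  assumes "permutation_poly (A_poly k :: 'a :: {field, finite} poly)" and "k \<ge> 1"
  shows "coprime k (card (UNIV :: 'a set) - 1)"
proof (rule ccontr)
  let ?Q = "card (UNIV :: 'a set) - 1"
  have inj: "inj (poly (A_poly k :: 'a poly))"
    using assms(1) by (simp add: permutation_poly_def bij_def)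
  have "card {0, 1 :: 'a} \<le> card (UNIV :: 'a set)" by (rule card_mono) auto
  hence "?Q > 0" by simp
  assume "\<not> coprime k ?Q"
  hence "gcd k ?Q \<noteq> 1" by (simp only: coprime_iff_gcd_eq_1 not_False_eq_True)
  then obtain r where "prime r" "r dvd gcd k ?Q" using prime_factor_nat by blast
  hence r: "prime r" "r dvd k" "r dvd ?Q" by (simp_all only: gcd_greatest_iff)
  obtain s where s: "k = r * s" using r(2) by (rule dvdE)
  obtain t where t: "?Q = r * t" using r(3) by (rule dvdE)
  have "0 < t" using \<open>?Q > 0\<close> unfolding t by simp
  moreover have "t < ?Q"
  proof -
    have "1 * t < r * t" using prime_gt_1_nat[OF r(1)] \<open>0 < t\<close> by (rule mult_strict_right_mono)
    thus ?thesis unfolding t by simp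
  qed
  \<comment> \<open>Since \<open>q - 1 = r * t\<close>, the power \<open>x ^ t\<close> has order
    dividing \<open>r\<close>, hence dividing \<open>k\<close>.\<close>
  ultimately obtain x :: 'a where x: "x \<noteq> 0" "x ^ t \<noteq> 1" using ex_power_neq_1 by blast
  define z where "z = x ^ t"
  have "z ^ k = (x ^ ?Q) ^ s" unfolding z_def s t by (simp add: power_mult[symmetric] mult_ac)
  hence zk: "z ^ k = 1" by (simp only: power_card_minus_1[OF x(1)] power_one)
  have z1: "z - 1 \<noteq> 0" using x by (simp add: z_def)
  have "inverse (z - 1) + 1 = z * inverse (z - 1)" using z1 by (simp add: field_simps)
  hence "poly (A_poly k) (inverse (z - 1)) = 0"
    by (simp add: poly_A_poly power_mult_distrib zk)
  also have "0 = poly (A_poly k) (0 :: 'a)" using assms(2) by (simp add: poly_A_poly power_0_left)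
  finally show False using injD[OF inj] z1 by fastforce
qed

section \<open>The double power sum, evaluated by permuting the nonzero elements\<close>

text \<open>For \<open>w \<noteq> 0\<close> the summand is \<open>G w ^ (u0 + u1 * p ^ j)\<close>,
  and \<open>G\<close> permutes the nonzero elements. Replacing \<open>a * p ^ j\<close> by a
  congruent \<open>b\<close> lets the exponent of \<open>w\<close> be written without negative
  powers.\<close>

lemma double_power_sum_eq_0:
  fixes p e k a b j u0 u1 :: nat
  assumes p: "prime p" and card: "card (UNIV :: 'a :: {field, finite} set) = p ^ e"
    and perm: "permutation_poly (A_poly k :: 'a poly)"
    and k: "k \<ge> 1" and a: "[k * a = 1] (mod (p ^ e - 1))" "a > 0"
    and b: "[b = a * p ^ j] (mod (p ^ e - 1))" "b > 0"
    and u: "\<not> p ^ e - 1 dvd u0 + u1 * p ^ j"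
    and le: "a * u0 + b * u1 < p ^ e - 1"
  shows "(\<Sum>w\<in>UNIV. ((1 + w) ^ a - 1) ^ (2 * u0) * ((1 + w) ^ b - 1) ^ (2 * u1) *
    w ^ (p ^ e - 1 - (a * u0 + b * u1))) = (0 :: 'a)"
proof -
  define Q where "Q = p ^ e - 1"
  have Q: "Q = card (UNIV :: 'a set) - 1" by (simp add: Q_def card)
  have CHAR: "CHAR('a) = p" by (rule CHAR_eq_if_card_eq_prime_power[OF p card])
  have inj: "inj (poly (A_poly k :: 'a poly))"
    using perm by (simp add: permutation_poly_def bij_def)
  \<comment> \<open>This includes \<open>x = 0\<close>, because \<open>a * k\<close> and
    \<open>1\<close> are both positive.\<close>
  have ak: "(x ^ a) ^ k = x" for x :: 'a
    using power_eq_power_if_cong[of "a * k" 1 x] a k by (simp add: power_mult mult.commute card)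
  have a_eq_1: "(1 + w) ^ a \<noteq> 1" if "w \<noteq> 0" for w :: 'a
    using ak[of "1 + w"] that by force
  define G where "G w = ((1 + w) ^ a - 1) ^ 2 / w ^ a" for w :: 'a
  have A_G: "poly (A_poly k) (inverse ((1 + w) ^ a - 1)) = inverse (G w ^ k)" if "w \<noteq> 0" for w :: 'a
  proof -
    define y where "y = (1 + w) ^ a - 1"
    have y: "y \<noteq> 0" using a_eq_1[OF that] by (simp add: y_def)
    have "inverse y + 1 = (1 + y) * inverse y" using y by (simp add: field_simps)
    moreover have "(1 + y) ^ k = 1 + w" using ak[of "1 + w"] by (simp add: y_def)
    ultimately have "(inverse y + 1) ^ k = (1 + w) * inverse y ^ k" by (simp add: power_mult_distrib)
    hence "poly (A_poly k) (inverse y) = w * (inverse y ^ k * inverse y ^ k)"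
      by (simp add: poly_A_poly distrib_right mult_ac)
    \<comment> \<open>Writing \<open>w\<close> as \<open>(w ^ a) ^ k\<close> turns the value into a
      \<open>k\<close>-th power.\<close>
    also have "\<dots> = inverse (G w ^ k)"
      unfolding G_def y_def[symmetric]
      by (simp add: power_divide ak power2_eq_square power_mult_distrib power_inverse divide_inverse mult_ac)
    finally show ?thesis by (simp add: y_def)
  qed
  have G_nz: "G w \<noteq> 0" if "w \<noteq> 0" for w using a_eq_1[OF that] that by (simp add: G_def)
  have G_inj: "inj_on G (UNIV - {0})"
  proof (rule inj_onI)
    fix v w assume *: "v \<in> UNIV - {0}" "w \<in> UNIV - {0}" "G v = G w"
    hence "poly (A_poly k) (inverse ((1 + v) ^ a - 1)) = poly (A_poly k) (inverse ((1 + w) ^ a - 1))"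
      by (simp add: A_G)
    hence "inverse ((1 + v) ^ a - 1) = inverse ((1 + w) ^ a - 1)" by (rule injD[OF inj])
    hence "((1 + v) ^ a) ^ k = ((1 + w) ^ a) ^ k" by simp
    thus "v = w" by (simp add: ak)
  qed
  have G_img: "G ` (UNIV - {0}) = UNIV - {0}"
    by (rule endo_inj_surj) (use G_inj G_nz in auto)
  define u where "u = u0 + u1 * p ^ j"
  have "u > 0" using u by (metis dvd_0_right gr0I u_def)
  have pos: "Q - (a * u0 + b * u1) > 0" using le by (simp add: Q_def)
  have G_power: "((1 + w) ^ a - 1) ^ (2 * u0) * ((1 + w) ^ b - 1) ^ (2 * u1) *
      w ^ (Q - (a * u0 + b * u1)) = G w ^ u" if w: "w \<noteq> 0" for w
  proof -
    \<comment> \<open>The iterated Frobenius map fixes \<open>1\<close>, so it turns the factor for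
      \<open>a\<close> into the one for \<open>b\<close>.\<close>
    have frob: "(x - 1) ^ p ^ j = x ^ p ^ j - 1" for x :: 'a
      using freshmans_dream'[of "p ^ j" j "x - 1" "1 :: 'a"] p by (simp add: CHAR)
    have pb: "x ^ b = (x ^ a) ^ p ^ j" for x :: 'a
      using power_eq_power_if_cong[of b "a * p ^ j" x] b a prime_gt_0_nat[OF p]
      by (simp add: power_mult card)
    have "w ^ (Q - (a * u0 + b * u1)) * w ^ (a * u0 + b * u1) = w ^ Q"
      using le by (simp add: Q_def power_add[symmetric])
    hence "w ^ (Q - (a * u0 + b * u1)) * w ^ (a * u0 + b * u1) = 1"
      using power_card_minus_1[OF w] unfolding Q[symmetric] by simp
    hence inv: "w ^ (Q - (a * u0 + b * u1)) = 1 / w ^ (a * u0 + b * u1)"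
      using w by (simp add: eq_divide_eq)
    have "G w ^ u0 = ((1 + w) ^ a - 1) ^ (2 * u0) / w ^ (a * u0)"
      by (simp add: G_def power_divide power_mult)
    moreover have "G w ^ p ^ j = (((1 + w) ^ a - 1) ^ p ^ j) ^ 2 / (w ^ a) ^ p ^ j"
      unfolding G_def power_divide by (simp only: power_mult[symmetric] mult.commute)
    hence "G w ^ p ^ j = ((1 + w) ^ b - 1) ^ 2 / w ^ b" by (simp only: frob pb)
    hence "(G w ^ p ^ j) ^ u1 = ((1 + w) ^ b - 1) ^ (2 * u1) / w ^ (b * u1)"
      by (simp add: power_divide power_mult)
    moreover have "G w ^ u = G w ^ u0 * (G w ^ p ^ j) ^ u1"
      unfolding u_def by (simp only: power_add power_mult mult.commute[of u1])
    ultimately show ?thesis unfolding inv by (simp add: power_add)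
  qed
  have "(\<Sum>w\<in>UNIV. ((1 + w) ^ a - 1) ^ (2 * u0) * ((1 + w) ^ b - 1) ^ (2 * u1) *
      w ^ (Q - (a * u0 + b * u1))) = (\<Sum>w\<in>UNIV - {0}. G w ^ u)"
    \<comment> \<open>The exponent of \<open>w\<close> is positive, so \<open>w = 0\<close>
      contributes nothing.\<close>
    by (rule sum.mono_neutral_cong_right) (use pos G_power in \<open>auto simp: power_0_left\<close>)
  also have "\<dots> = (\<Sum>w\<in>UNIV - {0}. w ^ u)"
    by (subst (2) G_img[symmetric]) (simp add: sum.reindex[OF G_inj])
  also have "\<dots> = (\<Sum>w\<in>UNIV. w ^ u)"
    by (rule sum.mono_neutral_left) (use \<open>u > 0\<close> in \<open>auto simp: power_0_left\<close>)
  also have "\<dots> = 0"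
    using u by (simp add: sum_powers_finite_field card u_def)
  finally show ?thesis by (simp add: Q_def)
qed

text \<open>The binomial coefficient divides \<open>fact (2 * u)\<close>, all of whose factors are
  below \<open>p\<close>.\<close>

lemma not_dvd_central_binomial:
  assumes "prime p" and "2 * u < p"
  shows "\<not> p dvd (2 * u choose u)"
proof
  assume "p dvd (2 * u choose u)"
  hence "p dvd fact u * fact (2 * u - u) * (2 * u choose u)" by simp
  hence "p dvd fact (2 * u)" using binomial_fact_lemma[of u "2 * u"] by simp
  thus False using assms prime_dvd_fact_iff by (metis not_le)
qed

text \<open>The double power sum vanishes because \<open>G\<close> is a permutation, yet it would be
  nonzero if \<open>(u0, u1)\<close> were the only admissible pair. The competing pair obtained here
  is what suitable choices of \<open>u0\<close> and \<open>u1\<close> rule out.\<close>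

lemma permutation_A_poly_unique_term:
  fixes A B :: "nat \<Rightarrow> nat" and p e k j u0 u1 :: nat
  defines "a \<equiv> \<Sum>i<e. A i * p ^ i" and "b \<equiv> \<Sum>i<e. B i * p ^ i"
    and "K \<equiv> \<lambda>i. u0 * A i + u1 * B i"
  assumes p: "prime p" and card: "card (UNIV :: 'a :: {field, finite} set) = p ^ e"
    and perm: "permutation_poly (A_poly k :: 'a poly)" and k: "k \<ge> 1"
    and a: "[k * a = 1] (mod (p ^ e - 1))" "a > 0"
    and b: "[b = a * p ^ j] (mod (p ^ e - 1))" "b > 0"
    and u: "0 < u0 + u1 * p ^ j" "u0 + u1 * p ^ j < p ^ e - 1" "2 * u0 < p" "2 * u1 < p"
    and K: "\<And>i. i < e \<Longrightarrow> K i \<le> p - 1"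
  shows "\<exists>v0 v1. v0 \<le> 2 * u0 \<and> v1 \<le> 2 * u1 \<and>
    (\<forall>i<e. K i \<le> v0 * A i + v1 * B i \<and> v0 * A i + v1 * B i \<le> p - 1) \<and> (v0, v1) \<noteq> (u0, u1)"
proof (rule ccontr)
  assume unique: "\<not> ?thesis"
  define Q where "Q = p ^ e - 1"
  have p2: "p \<ge> 2" using p by (rule prime_ge_2_nat)
  have ndvd: "\<not> Q dvd u0 + u1 * p ^ j" using u unfolding Q_def by (intro nat_dvd_not_less)
  have M: "a * u0 + b * u1 = (\<Sum>i<e. K i * p ^ i)"
    by (simp add: a_def b_def K_def sum_distrib_left sum.distrib algebra_simps)
  also have "\<dots> \<le> (\<Sum>i<e. (p - 1) * p ^ i)" using K by (intro sum_mono mult_le_mono1) auto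
  also have "\<dots> = Q" unfolding Q_def by (rule sum_full_digits) (use p2 in simp)
  finally have le: "a * u0 + b * u1 \<le> Q" .
  \<comment> \<open>Multiplication by \<open>k\<close> undoes \<open>a\<close> and recovers
    \<open>u0 + u1 * p ^ j\<close>, which is nonzero modulo \<open>Q\<close>. This excludes both end
    values \<open>0\<close> and \<open>Q\<close>.\<close>
  have "[k * (a * u0 + b * u1) = k * (a * u0 + a * p ^ j * u1)] (mod Q)"
    by (intro cong_mult cong_add cong_refl b(1)[folded Q_def])
  also have "k * (a * u0 + a * p ^ j * u1) = (k * a) * (u0 + u1 * p ^ j)"
    by (simp add: algebra_simps)
  also have "[\<dots> = 1 * (u0 + u1 * p ^ j)] (mod Q)"
    by (intro cong_mult cong_refl a(1)[folded Q_def])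
  finally have "[k * (a * u0 + b * u1) = u0 + u1 * p ^ j] (mod Q)" by simp
  hence "\<not> Q dvd k * (a * u0 + b * u1)" using ndvd by (simp add: cong_dvd_iff)
  hence "a * u0 + b * u1 \<noteq> Q" "a * u0 + b * u1 \<noteq> 0" by (auto intro: ccontr)
  with le have lt: "a * u0 + b * u1 < Q" by linarith
  have pos: "(\<Sum>i<e. K i * p ^ i) \<noteq> 0" using \<open>a * u0 + b * u1 \<noteq> 0\<close> unfolding M .
  have not_full: "\<exists>i<e. K i \<noteq> p - 1"
  proof (rule ccontr)
    assume "\<not> ?thesis"
    hence "(\<Sum>i<e. K i * p ^ i) = (\<Sum>i<e. (p - 1) * p ^ i)" by simp
    also have "\<dots> = Q" unfolding Q_def by (rule sum_full_digits) (use p2 in simp)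
    finally show False using lt M by simp
  qed
  have not_null: "\<exists>i<e. K i \<noteq> 0"
  proof (rule ccontr)
    assume "\<not> ?thesis"
    hence "(\<Sum>i<e. K i * p ^ i) = 0" by simp
    thus False using pos by contradiction
  qed
  have "(\<Sum>w\<in>UNIV. ((1 + w) ^ a - 1) ^ (2 * u0) * ((1 + w) ^ b - 1) ^ (2 * u1) *
      w ^ (p ^ e - 1 - (a * u0 + b * u1))) \<noteq> (0 :: 'a)"
    unfolding a_def b_def
  proof (rule double_power_sum_nonzero[OF p card])
    show "u0 * A i + u1 * B i \<le> p - 1" if "i < e" for i using K[OF that] by (simp only: K_def)
    show "\<exists>i<e. u0 * A i + u1 * B i \<noteq> p - 1" using not_full by (simp only: K_def)
    show "\<exists>i<e. u0 * A i + u1 * B i \<noteq> 0" using not_null by (simp only: K_def)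
    show "\<not> p dvd (2 * u0 choose u0)" "\<not> p dvd (2 * u1 choose u1)"
      using u not_dvd_central_binomial[OF p] by blast+
  next
    fix v0 v1
    assume "v0 \<le> 2 * u0" "v1 \<le> 2 * u1"
      and "\<And>i. i < e \<Longrightarrow> u0 * A i + u1 * B i \<le> v0 * A i + v1 * B i"
      and "\<And>i. i < e \<Longrightarrow> v0 * A i + v1 * B i \<le> p - 1"
    hence "(v0, v1) = (u0, u1)" using unique unfolding K_def by blast
    thus "v0 = u0 \<and> v1 = u1" by simp
  qed
  moreover have "(\<Sum>w\<in>UNIV. ((1 + w) ^ a - 1) ^ (2 * u0) * ((1 + w) ^ b - 1) ^ (2 * u1) *
      w ^ (p ^ e - 1 - (a * u0 + b * u1))) = (0 :: 'a)"
    by (rule double_power_sum_eq_0[OF p card perm k a b]) (use ndvd lt in \<open>simp_all add: Q_def\<close>)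
  ultimately show False by contradiction
qed

section \<open>The digits of the inverse exponent\<close>

lemma inverse_exponent_digit_le_1:
  fixes p e k a :: nat
  assumes p: "prime p" and card: "card (UNIV :: 'a :: {field, finite} set) = p ^ e"
    and perm: "permutation_poly (A_poly k :: 'a poly)" and k: "k \<ge> 1"
    and a: "[k * a = 1] (mod (p ^ e - 1))" "a > 0" "a < p ^ e"
    and i: "i < e"
  shows "a div p ^ i mod p \<le> 1"
proof (rule ccontr)
  assume big: "\<not> a div p ^ i mod p \<le> 1"
  define D where "D = (\<lambda>i. a div p ^ i mod p)"
  have p2: "p \<ge> 2" using p by (rule prime_ge_2_nat)
  have a_eq: "a = (\<Sum>i<e. D i * p ^ i)"
    using sum_digits[of p a e] p2 a(3) by (simp add: D_def)
  define M where "M = Max (D ` {..<e})"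
  have "M \<in> D ` {..<e}" unfolding M_def using i by (intro Max_in) auto
  then obtain l where l: "l < e" "D l = M" by auto
  have D_le: "D i \<le> M" if "i < e" for i using that by (simp add: M_def)
  have "M \<ge> 2" using big D_le[OF i] by (simp add: D_def)
  have "M < p" using l p2 by (auto simp: D_def)
  \<comment> \<open>The largest multiplier for which no digit of \<open>a * u\<close> carries;
    \<open>M \<ge> 2\<close> makes \<open>2 * u < p\<close>.\<close>
  define u where "u = (p - 1) div M"
  have u1: "u \<ge> 1" using \<open>M \<ge> 2\<close> \<open>M < p\<close> by (simp add: u_def Suc_le_eq div_greater_zero_iff)
  have uM: "u * M \<le> p - 1" by (simp add: u_def)
  have "2 * u \<le> u * M" using \<open>M \<ge> 2\<close> by simp
  hence u2: "2 * u < p" using uM p2 by linarith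
  have "p ^ 1 \<le> p ^ e" using i p2 by (intro power_increasing) auto
  hence uQ: "u < p ^ e - 1" using u1 u2 by simp
  have "\<exists>v0 v1. v0 \<le> 2 * u \<and> v1 \<le> 2 * 0 \<and> (\<forall>i<e. u * D i + 0 * D i \<le> v0 * D i + v1 * D i \<and>
      v0 * D i + v1 * D i \<le> p - 1) \<and> (v0, v1) \<noteq> (u, 0)"
  \<comment> \<open>With \<open>u1 = 0\<close> the second factor is trivial, and
    \<open>b = a\<close> serves as a placeholder.\<close>
  proof (rule permutation_A_poly_unique_term[OF p card perm k, where A = D and B = D and j = 0, folded a_eq])
    show "u * D i + 0 * D i \<le> p - 1" if "i < e" for i
      using order.trans[OF mult_le_mono2[OF D_le[OF that]] uM] by simp
  qed (use a u1 u2 uQ p2 in simp_all)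
  then obtain v0 v1 where v: "v1 \<le> 2 * 0" "(v0, v1) \<noteq> (u, 0)"
    "\<forall>i<e. u * D i + 0 * D i \<le> v0 * D i + v1 * D i \<and> v0 * D i + v1 * D i \<le> p - 1" by (elim exE conjE) (rule that)
  \<comment> \<open>The position of the maximal digit alone pins \<open>v0\<close> to
    \<open>u\<close>: domination bounds it below, and maximality of \<open>u\<close> bounds it
    above.\<close>
  have "u * M \<le> v0 * M" "v0 * M \<le> p - 1" using v(1) v(3)[rule_format, OF l(1)] l(2) by auto
  hence "u \<le> v0" "v0 \<le> u"
    using \<open>M \<ge> 2\<close> by (auto simp: u_def less_eq_div_iff_mult_less_eq)
  thus False using v(1,2) by simp
qed

lemma cong_power_mod_exponent:
  fixes p :: nat
  assumes "p > 0"
  shows "[p ^ n = p ^ (n mod e)] (mod (p ^ e - 1))"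
proof -
  have "[p ^ e = 1] (mod (p ^ e - 1))"
    using assms by (simp add: cong_altdef_nat Suc_le_eq)
  hence "[(p ^ e) ^ (n div e) * p ^ (n mod e) = 1 ^ (n div e) * p ^ (n mod e)] (mod (p ^ e - 1))"
    by (intro cong_mult cong_pow cong_refl)
  thus ?thesis by (simp add: power_mult[symmetric] power_add[symmetric])
qed

text \<open>Two digits 1 at distance \<open>j\<close> overlap when the digits are rotated by
  \<open>j\<close>. The overlap leaves one degree of freedom for a competing pair, and a nonzero
  deviation would make the digits of \<open>a\<close> invariant under a proper rotation, against the
  invertibility of \<open>a\<close>.\<close>

lemma inverse_exponent_digit_unique:
  fixes p e k a :: nat
  assumes p: "prime p" "odd p" and card: "card (UNIV :: 'a :: {field, finite} set) = p ^ e"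
    and perm: "permutation_poly (A_poly k :: 'a poly)" and k: "k \<ge> 1"
    and a: "[k * a = 1] (mod (p ^ e - 1))" "a > 0" "a < p ^ e"
    and l: "l < l'" "l' < e"
  shows "a div p ^ l mod p = 0 \<or> a div p ^ l' mod p = 0"
proof (rule ccontr)
  assume nz: "\<not> ?thesis"
  define D where "D = (\<lambda>i. a div p ^ i mod p)"
  have p2: "p \<ge> 2" using p(1) by (rule prime_ge_2_nat)
  hence p3: "p \<ge> 3" using p(2) by (cases "p = 2") auto
  have a_eq: "a = (\<Sum>i<e. D i * p ^ i)"
    using sum_digits[of p a e] p2 a(3) by (simp add: D_def)
  have D1: "D i \<le> 1" if "i < e" for i
    unfolding D_def by (rule inverse_exponent_digit_le_1[OF p(1) card perm k a that])
  have Dl: "D l = 1" "D l' = 1"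
    using nz D1[of l] D1[of l'] l by (auto simp: D_def)
  define j where "j = l' - l"
  have j: "0 < j" "j < e" using l by (auto simp: j_def)
  \<comment> \<open>\<open>B\<close> is the cyclic shift of the digits of \<open>a\<close> by \<open>j\<close>, i.e. the digits of \<open>a * p ^ j\<close> reduced modulo \<open>p ^ e - 1\<close>.\<close>
  define s where "s = (\<lambda>i. (i + (e - j)) mod e)"
  define B where "B = (\<lambda>i. D (s i))"
  define b where "b = (\<Sum>i<e. B i * p ^ i)"
  have s_lt: "s i < e" for i using l by (simp add: s_def)
  have s_shift: "s ((i + j) mod e) = i" "(s i + j) mod e = i" if "i < e" for i
    using that j mod_add_left_eq[of "i + j" e "e - j"] mod_add_left_eq[of "i + (e - j)" e j]
    by (simp_all add: s_def)
  \<comment> \<open>This reindexing gives both the congruence for \<open>b\<close> and the equality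
    of the digit sums of \<open>a\<close> and \<open>b\<close>.\<close>
  have rot: "(\<Sum>i<e. f (s i) i) = (\<Sum>i<e. f i ((i + j) mod e))" for f :: "nat \<Rightarrow> nat \<Rightarrow> nat"
    by (rule sum.reindex_bij_witness[of _ "\<lambda>i. (i + j) mod e" s]) (use s_lt s_shift l in auto)
  have "[(\<Sum>i<e. D i * p ^ ((i + j) mod e)) = (\<Sum>i<e. D i * p ^ (i + j))] (mod (p ^ e - 1))"
    by (intro cong_sum cong_mult cong_refl cong_sym[OF cong_power_mod_exponent] prime_gt_0_nat[OF p(1)])
  also have "(\<Sum>i<e. D i * p ^ (i + j)) = a * p ^ j"
    unfolding power_add mult.assoc[symmetric] sum_distrib_right[symmetric] a_eq[symmetric] ..
  finally have b_cong: "[b = a * p ^ j] (mod (p ^ e - 1))"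
    unfolding b_def B_def using rot[of "\<lambda>x y. D x * p ^ y"] by simp
  \<comment> \<open>The rotation carries digit \<open>l\<close> to position \<open>l'\<close>, where
    it meets digit \<open>l'\<close> of \<open>a\<close>.\<close>
  have sl': "s l' = l" using s_shift(1)[of l] l by (simp add: j_def)
  have "B l' * p ^ l' \<le> b" unfolding b_def by (rule member_le_sum) (use l in auto)
  hence "b > 0" using Dl sl' p2 by (auto simp: B_def intro: gr0I)
  \<comment> \<open>Two overlapping digits 1 then add up to exactly \<open>p - 1\<close>, without a
    carry.\<close>
  define h where "h = (p - 1) div 2"
  have h: "2 * h = p - 1" "h \<ge> 1" using p(2) p3 by (auto simp: h_def)
  have hQ: "h + h * p ^ j < p ^ e - 1"
  proof -
    have "p ^ 1 \<le> p ^ j" using j p2 by (intro power_increasing) auto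
    hence "h < p ^ j" using h p3 by simp
    moreover have "p ^ Suc j \<le> p ^ e" using j p2 by (intro power_increasing) auto
    moreover have "(h + h + 1) * p ^ j = p ^ Suc j" using h p3 by (simp add: mult_2)
    moreover have "1 * p ^ j \<le> h * p ^ j" using h by (intro mult_le_mono1) auto
    ultimately show ?thesis unfolding distrib_right by linarith
  qed
  have "\<exists>v0 v1. v0 \<le> 2 * h \<and> v1 \<le> 2 * h \<and> (\<forall>i<e. h * D i + h * B i \<le> v0 * D i + v1 * B i \<and>
      v0 * D i + v1 * B i \<le> p - 1) \<and> (v0, v1) \<noteq> (h, h)"
  proof (rule permutation_A_poly_unique_term[OF p(1) card perm k, where A = D and B = B and j = j, folded a_eq b_def])
    show "h * D i + h * B i \<le> p - 1" if "i < e" for i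
    proof -
      have "h * D i + h * B i \<le> h * 1 + h * 1"
        using D1[OF that] D1[OF s_lt] unfolding B_def by (intro add_mono mult_le_mono2) auto
      thus ?thesis using h by simp
    qed
  qed (use a b_cong \<open>b > 0\<close> h hQ p2 in simp_all)
  then obtain v0 v1 where v: "(v0, v1) \<noteq> (h, h)"
    "\<forall>i<e. h * D i + h * B i \<le> v0 * D i + v1 * B i \<and> v0 * D i + v1 * B i \<le> p - 1" by (elim exE conjE) (rule that)
  \<comment> \<open>Position \<open>l'\<close> carries the full digit \<open>h + h = p - 1\<close>.\<close>
  have v_sum: "v0 + v1 = 2 * h"
    using v(2)[rule_format, OF l(2)] Dl sl' h by (simp add: B_def)
  define t where "t = int v0 - int h"
  have t: "int v0 = int h + t" "int v1 = int h - t" using v_sum by (auto simp: t_def)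
  have "t \<noteq> 0" using v(1) v_sum by (auto simp: t_def)
  \<comment> \<open>With \<open>v0 = h + t\<close> and \<open>v1 = h - t\<close>, the terms in
    \<open>h\<close> cancel from the domination inequality.\<close>
  have nonneg: "t * (int (D i) - int (B i)) \<ge> 0" if "i < e" for i
  proof -
    have "int (h * D i + h * B i) \<le> int (v0 * D i + v1 * B i)" using v(2) that by (intro of_nat_mono) auto
    thus ?thesis by (simp add: t algebra_simps)
  qed
  \<comment> \<open>Rotation preserves the digit sum, so the nonnegative terms above add up to zero
    and all vanish.\<close>
  have "(\<Sum>i<e. B i) = (\<Sum>i<e. D i)" unfolding B_def using rot[of "\<lambda>x y. D x"] by simp
  hence "(\<Sum>i<e. t * (int (D i) - int (B i))) = 0"
    by (simp add: sum_distrib_left[symmetric] sum_subtractf of_nat_sum[symmetric] del: of_nat_sum)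
  hence "t * (int (D i) - int (B i)) = 0" if "i < e" for i
    using nonneg that by (subst (asm) sum_nonneg_eq_0_iff) auto
  hence "D i = B i" if "i < e" for i using \<open>t \<noteq> 0\<close> that by simp
  hence "b = a" unfolding b_def by (subst a_eq) simp
  \<comment> \<open>Multiplying by \<open>k\<close> cancels \<open>a\<close> and leaves
    \<open>p ^ j\<close> congruent to \<open>1\<close>, impossible for
    \<open>0 < j < e\<close>.\<close>
  hence "[k * (a * p ^ j) = k * a] (mod (p ^ e - 1))"
    using b_cong by (intro cong_mult cong_refl) (auto intro: cong_sym)
  moreover have "[k * (a * p ^ j) = 1 * p ^ j] (mod (p ^ e - 1))"
    unfolding mult.assoc[symmetric] by (intro cong_mult cong_refl a)
  ultimately have "[p ^ j = 1] (mod (p ^ e - 1))"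
    using a(1) by (metis cong_sym cong_trans mult_1)
  moreover have "p ^ 0 < p ^ j" by (rule power_strict_increasing) (use j p2 in auto)
  moreover have "p ^ j < p ^ e" by (rule power_strict_increasing) (use j p2 in auto)
  ultimately have "p ^ e - 1 dvd p ^ j - 1" "0 < p ^ j - 1" "p ^ j - 1 < p ^ e - 1"
    by (simp_all add: cong_altdef_nat)
  thus False using nat_dvd_not_less by blast
qed

section \<open>The two directions of the equivalence\<close>

lemma permutation_A_poly_imp_prime_power:
  fixes p e k :: nat
  assumes p: "prime p" "odd p" and e: "e > 0"
    and card: "card (UNIV :: 'a :: {field, finite} set) = p ^ e"
    and perm: "permutation_poly (A_poly k :: 'a poly)" and k: "1 \<le> k" "k \<le> p ^ e - 1"
  shows "\<exists>i. k = p ^ i"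
proof -
  define Q where "Q = p ^ e - 1"
  have p2: "p \<ge> 2" using p(1) by (rule prime_ge_2_nat)
  hence p3: "p \<ge> 3" using p(2) by (cases "p = 2") auto
  have "p ^ 1 \<le> p ^ e" using e p2 by (intro power_increasing) auto
  hence Q2: "Q \<ge> 2" using p3 by (simp add: Q_def)
  have "coprime k Q" using coprime_if_permutation_A_poly[OF perm k(1)] by (simp add: card Q_def)
  then obtain a' where "[k * a' = 1] (mod Q)" using cong_solve_coprime_nat by auto
  define a where "a = a' mod Q"
  have a1: "[k * a = 1] (mod Q)"
    using \<open>[k * a' = 1] (mod Q)\<close> by (simp add: a_def cong_def mod_mult_right_eq)
  have "a > 0"
  proof (rule gr0I)
    assume "a = 0"
    thus False using a1 Q2 by (simp add: cong_def)
  qed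
  have "a < Q" using Q2 by (simp add: a_def)
  hence a2: "a < p ^ e" by (simp add: Q_def)
  define D where "D = (\<lambda>i. a div p ^ i mod p)"
  have a_eq: "a = (\<Sum>i<e. D i * p ^ i)"
    using sum_digits[of p a e] p2 a2 by (simp add: D_def)
  have "\<exists>l<e. D l \<noteq> 0"
  proof (rule ccontr)
    assume "\<not> ?thesis"
    hence "(\<Sum>i<e. D i * p ^ i) = 0" by simp
    thus False using \<open>a > 0\<close> a_eq by linarith
  qed
  then obtain l where l: "l < e" "D l \<noteq> 0" by blast
  have "D l = 1"
    using inverse_exponent_digit_le_1[OF p(1) card perm k(1) a1[unfolded Q_def] \<open>a > 0\<close> a2 l(1)] l(2)
    by (simp add: D_def)
  have "D i = 0" if "i < e" "i \<noteq> l" for i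
    using inverse_exponent_digit_unique[OF p card perm k(1) a1[unfolded Q_def] \<open>a > 0\<close> a2, of i l]
      inverse_exponent_digit_unique[OF p card perm k(1) a1[unfolded Q_def] \<open>a > 0\<close> a2, of l i]
      that l by (auto simp: D_def neq_iff)
  hence "(\<Sum>i<e. D i * p ^ i) = (\<Sum>i\<in>{l}. D i * p ^ i)"
    using l(1) by (intro sum.mono_neutral_right) auto
  hence "a = p ^ l" using a_eq \<open>D l = 1\<close> by simp
  \<comment> \<open>The inverse of \<open>p ^ l\<close> is \<open>p ^ (e - l)\<close>; the reduction
    modulo \<open>e\<close> matters for \<open>l = 0\<close>, where it gives
    \<open>r = 0\<close>.\<close>
  define r where "r = (e - l) mod e"
  have "[k * p ^ l * p ^ (e - l) = 1 * p ^ r] (mod Q)"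
    unfolding r_def Q_def by (intro cong_mult cong_power_mod_exponent prime_gt_0_nat[OF p(1)] a1[unfolded \<open>a = p ^ l\<close> Q_def])
  also have "k * p ^ l * p ^ (e - l) = k * p ^ e"
    using l(1) by (simp add: mult.assoc power_add[symmetric])
  finally have "[k * p ^ e = p ^ r] (mod Q)" by simp
  moreover have "[k * p ^ e = k * p ^ 0] (mod Q)"
    unfolding Q_def using cong_power_mod_exponent[of p e e] p2 by (intro cong_mult cong_refl) simp
  ultimately have "[k = p ^ r] (mod Q)" by (simp add: cong_def)
  moreover have "p ^ r \<ge> 1" using p2 by simp
  moreover have lt: "p ^ r - 1 < Q" "k - 1 < Q"
  proof -
    have "p ^ r < p ^ e" unfolding r_def using e p2 by (intro power_strict_increasing) auto
    thus "p ^ r - 1 < Q" "k - 1 < Q" using k \<open>p ^ r \<ge> 1\<close> by (simp_all add: Q_def)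
  qed
  \<comment> \<open>Both \<open>k\<close> and \<open>p ^ r\<close> lie between \<open>1\<close> and
    \<open>Q\<close>, so subtracting 1 places them in the standard residue range, where congruence
    is equality.\<close>
  ultimately have "[(k - 1) + 1 = (p ^ r - 1) + 1] (mod Q)"
    using k(1) by (simp only: le_add_diff_inverse2)
  hence "[k - 1 = p ^ r - 1] (mod Q)" by (simp only: cong_add_rcancel_nat)
  hence "k - 1 = p ^ r - 1" using lt by (simp add: cong_def)
  hence "k = p ^ r" using k(1) \<open>p ^ r \<ge> 1\<close> by linarith
  thus ?thesis ..
qed

text \<open>For \<open>k = p ^ i\<close> additivity of the Frobenius power reduces the bracket to
  \<open>1\<close>, so \<open>A_poly k\<close> acts as \<open>x ^ p ^ i\<close>, an injective
  map.\<close>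

lemma permutation_A_poly_prime_power:
  assumes "prime p" and "card (UNIV :: 'a :: {field, finite} set) = p ^ e"
  shows "permutation_poly (A_poly (p ^ i) :: 'a poly)"
proof -
  have CHAR: "CHAR('a) = p" by (rule CHAR_eq_if_card_eq_prime_power[OF assms])
  have add: "(x + y) ^ p ^ i = x ^ p ^ i + y ^ p ^ i" for x y :: 'a
    by (rule freshmans_dream') (use assms CHAR in auto)
  have "inj (\<lambda>x::'a. x ^ p ^ i)"
  proof (rule injI)
    fix x y :: 'a
    assume "x ^ p ^ i = y ^ p ^ i"
    hence "(x - y) ^ p ^ i = 0" using add[of "x - y" y] by simp
    thus "x = y" by simp
  qed
  hence "bij (\<lambda>x::'a. x ^ p ^ i)" by (simp add: finite_UNIV_inj_surj bij_def)
  thus ?thesis by (simp add: permutation_poly_def poly_A_poly add)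
qed

theorem mainTheorem1:
  fixes p e q k :: nat
  assumes "prime p" and "odd p" and "e > 0" and "q = p ^ e"
    and "card (UNIV :: 'a :: {field, finite} set) = q"
    and "1 \<le> k" and "k \<le> q - 1"
  shows "permutation_poly (A_poly k :: 'a poly) \<longleftrightarrow> (\<exists>i. k = p ^ i)"
  using permutation_A_poly_imp_prime_power[of p e, where 'a = 'a and k = k]
    permutation_A_poly_prime_power[of p e, where 'a = 'a] assms by auto

end
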